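(* Let $\sigma$ be a signature. For all sets $\Gamma\subseteq\mathrm{Sent}_\sigma$ and $\Delta\subseteq\mathrm{Form}_\sigma$: if $\Gamma\vdash\Delta$ then $\Gamma\vDash\Delta$.
   Context: Syntax. Signature $\sigma$: predicate symbols (with arities) and constants, no function symbols; terms are variables (from a fixed countable set) and constants. $\mathrm{Form}_\sigma$: formulas built from atomic formulas and $\bot$ by $\rightarrow,\wedge,\vee$, strong negation $\sim$, $\Box,\Diamond$, $\forall x,\exists x$; $\mathrm{Sent}_\sigma$: sentences. Abbreviations: $\neg\Phi:=\Phi\rightarrow\bot$, $\Phi\leftrightarrow\Psi:=(\Phi\rightarrow\Psi)\wedge(\Psi\rightarrow\Phi)$, $\Phi\Leftrightarrow\Psi:=(\Phi\leftrightarrow\Psi)\wedge({\sim\Phi}\leftrightarrow{\sim\Psi})$; $\Phi(x/t)$ is substitution. Calculus. $\mathsf{QBK}_\sigma$ is the smallest set of $\sigma$-formulas containing all instances of: $\Phi\rightarrow(\Psi\rightarrow\Phi)$; $(\Phi\rightarrow(\Psi\rightarrow\Theta))\rightarrow((\Phi\rightarrow\Psi)\rightarrow(\Phi\rightarrow\Theta))$; $\Phi\wedge\Psi\rightarrow\Phi$; $\Phi\wedge\Psi\rightarrow\Psi$; $\Phi\rightarrow(\Psi\rightarrow\Phi\wedge\Psi)$; $\Phi\rightarrow\Phi\vee\Psi$; $\Psi\rightarrow\Phi\vee\Psi$; $(\Phi\rightarrow\Theta)\rightarrow((\Psi\rightarrow\Theta)\rightarrow(\Phi\vee\Psi\rightarrow\Theta))$;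 $\Phi\vee(\Phi\rightarrow\bot)$; $\bot\rightarrow\Phi$; ${\sim\sim\Phi}\leftrightarrow\Phi$; ${\sim(\Phi\rightarrow\Psi)}\leftrightarrow(\Phi\wedge{\sim\Psi})$; ${\sim(\Phi\vee\Psi)}\leftrightarrow({\sim\Phi}\wedge{\sim\Psi})$; ${\sim(\Phi\wedge\Psi)}\leftrightarrow({\sim\Phi}\vee{\sim\Psi})$; ${\sim\bot}$; $(\Box\Phi\wedge\Box\Psi)\rightarrow\Box(\Phi\wedge\Psi)$; $\Box(\Phi\rightarrow\Phi)$; $\neg\Box\Phi\leftrightarrow\Diamond\neg\Phi$; $\neg\Diamond\Phi\leftrightarrow\Box\neg\Phi$; $\Box\Phi\Leftrightarrow{\sim\Diamond{\sim\Phi}}$; $\Diamond\Phi\Leftrightarrow{\sim\Box{\sim\Phi}}$; $\forall x\Phi\rightarrow\Phi(x/t)$, $\Phi(x/t)\rightarrow\exists x\Phi$ ($t$ free for $x$ in $\Phi$); ${\sim\forall x\Phi}\leftrightarrow\exists x{\sim\Phi}$; ${\sim\exists x\Phi}\leftrightarrow\forall x{\sim\Phi}$; closed under MP (from $\Phi,\Phi\rightarrow\Psi$ infer $\Psi$), MB (from $\Phi\rightarrow\Psi$ infer $\Box\Phi\rightarrow\Box\Psi$), MD (from $\Phi\rightarrow\Psi$ infer $\Diamond\Phi\rightarrow\Diamond\Psi$), BR1 (from $\Phi\rightarrow\Psi$ infer $\Phi\rightarrow\forall x\Psi$, $x$ not free in $\Phi$), BR2 (from $\Phi\rightarrow\Psi$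 infer $\exists x\Phi\rightarrow\Psi$, $x$ not free in $\Psi$). $\mathrm{Disj}(\Delta)$ is the set of disjunctions of finitely many elements of $\Delta$ (empty disjunction $=\bot$). $\Gamma\vdash\Delta$ iff some element of $\mathrm{Disj}(\Delta)$ is obtainable from $\Gamma\cup\mathsf{QBK}_\sigma$ using only MP, BR1, BR2. Semantics. A $\mathsf{QBK}_\sigma$-model is $\mathcal M=\langle\langle W,R\rangle,(\mathfrak A^+_w),(\mathfrak A^-_w)\rangle$ ($W\ne\emptyset$, $R\subseteq W\times W$), $\mathfrak A^\pm_w$ $\sigma$-structures with common domain $A_w$ and equal interpretation of constants, with $uRv\Rightarrow A_u\subseteq A_v$ and constants of $\sigma$ interpreted equally in $\mathfrak A^+_u,\mathfrak A^+_v$. $A$-sentences: sentences over $\sigma$ plus constants $\underline a$ ($a\in A$) naming $a$; ground $A$-substitutions map variables to such constants. Verification/falsification at $w$: atomic by $\mathfrak A^+_w$ / $\mathfrak A^-_w$; $\bot$ never verified, always falsified; $\wedge$: verified iff both verified, falsified iff one falsified; $\vee$ dually; $\Phi\rightarrow\Psi$: verified iff $\Phi$ not verified or $\Psi$ verified, falsified iff $\Phi$ verified and $\Psi$ falsified; $\sim$ swaps; $\Box\Phi$: verified iff $\Phi$ verified at all $R$-successors, falsified iff falsified at some $R$-successor; $\Diamond\Phi$: verified iff verified at some $R$-successor, falsified iff falsified at all $R$-successors; $\forall x\Phi$: verified iff $\Phi(x/\underline a)$ verified for all $a\in A_w$, falsified iff falsified for some; $\exists x\Phi$: verified iff verified for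 some $a\in A_w$, falsified iff falsified for all. $\Gamma\vDash\Delta$ iff for every model $\mathcal M$, world $w$, ground $A_w$-substitution $\lambda$: if all of $\Gamma$ is verified at $w$ then $\lambda\Psi$ is verified at $w$ for some $\Psi\in\Delta$. *)

theory Defs
  imports Main
begin

type_synonym var = nat

datatype 'c tm = Var var | Const 'c

datatype ('p, 'c) fm =
    Atom 'p "'c tm list"
  | Bot  ("\<^bold>\<bottom>")
  | Imp "('p, 'c) fm" "('p, 'c) fm"  (infixr "\<^bold>\<rightarrow>" 55)
  | And "('p, 'c) fm" "('p, 'c) fm"  (infixr "\<^bold>\<and>" 65)
  | Or "('p, 'c) fm" "('p, 'c) fm"  (infixr "\<^bold>\<or>" 60)
  | SNeg "('p, 'c) fm"  ("\<^bold>\<sim> _" [80] 80)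
  | Box "('p, 'c) fm"  ("\<^bold>\<box> _" [80] 80)
  | Dia "('p, 'c) fm"  ("\<^bold>\<diamond> _" [80] 80)
  | All var "('p, 'c) fm"
  | Ex var "('p, 'c) fm"

abbreviation Neg :: "('p, 'c) fm \<Rightarrow> ('p, 'c) fm"  ("\<^bold>\<not> _" [80] 80)
  where "\<^bold>\<not> \<phi> \<equiv> \<phi> \<^bold>\<rightarrow> \<^bold>\<bottom>"

abbreviation Iff :: "('p, 'c) fm \<Rightarrow> ('p, 'c) fm \<Rightarrow> ('p, 'c) fm"  (infix "\<^bold>\<leftrightarrow>" 52)
  where "\<phi> \<^bold>\<leftrightarrow> \<psi> \<equiv> (\<phi> \<^bold>\<rightarrow> \<psi>) \<^bold>\<and> (\<psi> \<^bold>\<rightarrow> \<phi>)"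

abbreviation SIff :: "('p, 'c) fm \<Rightarrow> ('p, 'c) fm \<Rightarrow> ('p, 'c) fm"  (infix "\<^bold>\<Leftrightarrow>" 52)
  where "\<phi> \<^bold>\<Leftrightarrow> \<psi> \<equiv> (\<phi> \<^bold>\<leftrightarrow> \<psi>) \<^bold>\<and> (\<^bold>\<sim> \<phi> \<^bold>\<leftrightarrow> \<^bold>\<sim> \<psi>)"

text \<open>The symbols of a signature form subsets of the types \<open>'p\<close> and \<open>'c\<close>, so that a signature may
  have no constants or no predicate symbols.\<close>

record ('p, 'c) signature =
  preds :: "'p set"
  arity :: "'p \<Rightarrow> nat"
  consts_of :: "'c set"

primrec wf_tm :: "('p, 'c) signature \<Rightarrow> 'c tm \<Rightarrow> bool" where
  "wf_tm \<sigma> (Var x) = True"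
| "wf_tm \<sigma> (Const c) = (c \<in> consts_of \<sigma>)"

primrec wf_fm :: "('p, 'c) signature \<Rightarrow> ('p, 'c) fm \<Rightarrow> bool" where
  "wf_fm \<sigma> (Atom P ts) = (P \<in> preds \<sigma> \<and> length ts = arity \<sigma> P \<and> (\<forall>t\<in>set ts. wf_tm \<sigma> t))"
| "wf_fm \<sigma> \<^bold>\<bottom> = True"
| "wf_fm \<sigma> (\<phi> \<^bold>\<rightarrow> \<psi>) = (wf_fm \<sigma> \<phi> \<and> wf_fm \<sigma> \<psi>)"
| "wf_fm \<sigma> (\<phi> \<^bold>\<and> \<psi>) = (wf_fm \<sigma> \<phi> \<and> wf_fm \<sigma> \<psi>)"
| "wf_fm \<sigma> (\<phi> \<^bold>\<or> \<psi>) = (wf_fm \<sigma> \<phi> \<and> wf_fm \<sigma> \<psi>)"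
| "wf_fm \<sigma> (\<^bold>\<sim> \<phi>) = wf_fm \<sigma> \<phi>"
| "wf_fm \<sigma> (\<^bold>\<box> \<phi>) = wf_fm \<sigma> \<phi>"
| "wf_fm \<sigma> (\<^bold>\<diamond> \<phi>) = wf_fm \<sigma> \<phi>"
| "wf_fm \<sigma> (All x \<phi>) = wf_fm \<sigma> \<phi>"
| "wf_fm \<sigma> (Ex x \<phi>) = wf_fm \<sigma> \<phi>"

primrec fv_tm :: "'c tm \<Rightarrow> var set" where
  "fv_tm (Var x) = {x}"
| "fv_tm (Const c) = {}"

primrec fv :: "('p, 'c) fm \<Rightarrow> var set" where
  "fv (Atom P ts) = (\<Union>t\<in>set ts. fv_tm t)"
| "fv \<^bold>\<bottom> = {}"
| "fv (\<phi> \<^bold>\<rightarrow> \<psi>) = fv \<phi> \<union> fv \<psi>"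
| "fv (\<phi> \<^bold>\<and> \<psi>) = fv \<phi> \<union> fv \<psi>"
| "fv (\<phi> \<^bold>\<or> \<psi>) = fv \<phi> \<union> fv \<psi>"
| "fv (\<^bold>\<sim> \<phi>) = fv \<phi>"
| "fv (\<^bold>\<box> \<phi>) = fv \<phi>"
| "fv (\<^bold>\<diamond> \<phi>) = fv \<phi>"
| "fv (All x \<phi>) = fv \<phi> - {x}"
| "fv (Ex x \<phi>) = fv \<phi> - {x}"

definition Form :: "('p, 'c) signature \<Rightarrow> ('p, 'c) fm set" where
  "Form \<sigma> = {\<phi>. wf_fm \<sigma> \<phi>}"

definition Sent :: "('p, 'c) signature \<Rightarrow> ('p, 'c) fm set" where
  "Sent \<sigma> = {\<phi> \<in> Form \<sigma>. fv \<phi> = {}}"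

text \<open>Simultaneous replacement of the free occurrences of variables, without renaming of bound
  variables.\<close>

primrec ssubst_tm :: "(var \<Rightarrow> 'c tm) \<Rightarrow> 'c tm \<Rightarrow> 'c tm" where
  "ssubst_tm s (Var x) = s x"
| "ssubst_tm s (Const c) = Const c"

primrec ssubst :: "(var \<Rightarrow> 'c tm) \<Rightarrow> ('p, 'c) fm \<Rightarrow> ('p, 'c) fm" where
  "ssubst s (Atom P ts) = Atom P (map (ssubst_tm s) ts)"
| "ssubst s \<^bold>\<bottom> = \<^bold>\<bottom>"
| "ssubst s (\<phi> \<^bold>\<rightarrow> \<psi>) = ssubst s \<phi> \<^bold>\<rightarrow> ssubst s \<psi>"
| "ssubst s (\<phi> \<^bold>\<and> \<psi>) = ssubst s \<phi> \<^bold>\<and> ssubst s \<psi>"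
| "ssubst s (\<phi> \<^bold>\<or> \<psi>) = ssubst s \<phi> \<^bold>\<or> ssubst s \<psi>"
| "ssubst s (\<^bold>\<sim> \<phi>) = \<^bold>\<sim> (ssubst s \<phi>)"
| "ssubst s (\<^bold>\<box> \<phi>) = \<^bold>\<box> (ssubst s \<phi>)"
| "ssubst s (\<^bold>\<diamond> \<phi>) = \<^bold>\<diamond> (ssubst s \<phi>)"
| "ssubst s (All x \<phi>) = All x (ssubst (s(x := Var x)) \<phi>)"
| "ssubst s (Ex x \<phi>) = Ex x (ssubst (s(x := Var x)) \<phi>)"

definition subst :: "('p, 'c) fm \<Rightarrow> var \<Rightarrow> 'c tm \<Rightarrow> ('p, 'c) fm" where
  "subst \<phi> x t = ssubst (Var(x := t)) \<phi>"

primrec free_for :: "'c tm \<Rightarrow> var \<Rightarrow> ('p, 'c) fm \<Rightarrow> bool" where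
  "free_for t x (Atom P ts) = True"
| "free_for t x \<^bold>\<bottom> = True"
| "free_for t x (\<phi> \<^bold>\<rightarrow> \<psi>) = (free_for t x \<phi> \<and> free_for t x \<psi>)"
| "free_for t x (\<phi> \<^bold>\<and> \<psi>) = (free_for t x \<phi> \<and> free_for t x \<psi>)"
| "free_for t x (\<phi> \<^bold>\<or> \<psi>) = (free_for t x \<phi> \<and> free_for t x \<psi>)"
| "free_for t x (\<^bold>\<sim> \<phi>) = free_for t x \<phi>"
| "free_for t x (\<^bold>\<box> \<phi>) = free_for t x \<phi>"
| "free_for t x (\<^bold>\<diamond> \<phi>) = free_for t x \<phi>"
| "free_for t x (All y \<phi>) = (x \<notin> fv (All y \<phi>) \<or> (y \<notin> fv_tm t \<and> free_for t x \<phi>))"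
| "free_for t x (Ex y \<phi>) = (x \<notin> fv (Ex y \<phi>) \<or> (y \<notin> fv_tm t \<and> free_for t x \<phi>))"

inductive QBK_axiom :: "('p, 'c) fm \<Rightarrow> bool" where
  "QBK_axiom (\<phi> \<^bold>\<rightarrow> (\<psi> \<^bold>\<rightarrow> \<phi>))"
| "QBK_axiom ((\<phi> \<^bold>\<rightarrow> (\<psi> \<^bold>\<rightarrow> \<theta>)) \<^bold>\<rightarrow> ((\<phi> \<^bold>\<rightarrow> \<psi>) \<^bold>\<rightarrow> (\<phi> \<^bold>\<rightarrow> \<theta>)))"
| "QBK_axiom ((\<phi> \<^bold>\<and> \<psi>) \<^bold>\<rightarrow> \<phi>)"
| "QBK_axiom ((\<phi> \<^bold>\<and> \<psi>) \<^bold>\<rightarrow> \<psi>)"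
| "QBK_axiom (\<phi> \<^bold>\<rightarrow> (\<psi> \<^bold>\<rightarrow> (\<phi> \<^bold>\<and> \<psi>)))"
| "QBK_axiom (\<phi> \<^bold>\<rightarrow> (\<phi> \<^bold>\<or> \<psi>))"
| "QBK_axiom (\<psi> \<^bold>\<rightarrow> (\<phi> \<^bold>\<or> \<psi>))"
| "QBK_axiom ((\<phi> \<^bold>\<rightarrow> \<theta>) \<^bold>\<rightarrow> ((\<psi> \<^bold>\<rightarrow> \<theta>) \<^bold>\<rightarrow> ((\<phi> \<^bold>\<or> \<psi>) \<^bold>\<rightarrow> \<theta>)))"
| "QBK_axiom (\<phi> \<^bold>\<or> (\<phi> \<^bold>\<rightarrow> \<^bold>\<bottom>))"
| "QBK_axiom (\<^bold>\<bottom> \<^bold>\<rightarrow> \<phi>)"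
| "QBK_axiom (\<^bold>\<sim> (\<^bold>\<sim> \<phi>) \<^bold>\<leftrightarrow> \<phi>)"
| "QBK_axiom (\<^bold>\<sim> (\<phi> \<^bold>\<rightarrow> \<psi>) \<^bold>\<leftrightarrow> (\<phi> \<^bold>\<and> \<^bold>\<sim> \<psi>))"
| "QBK_axiom (\<^bold>\<sim> (\<phi> \<^bold>\<or> \<psi>) \<^bold>\<leftrightarrow> (\<^bold>\<sim> \<phi> \<^bold>\<and> \<^bold>\<sim> \<psi>))"
| "QBK_axiom (\<^bold>\<sim> (\<phi> \<^bold>\<and> \<psi>) \<^bold>\<leftrightarrow> (\<^bold>\<sim> \<phi> \<^bold>\<or> \<^bold>\<sim> \<psi>))"
| "QBK_axiom (\<^bold>\<sim> \<^bold>\<bottom>)"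
| "QBK_axiom ((\<^bold>\<box> \<phi> \<^bold>\<and> \<^bold>\<box> \<psi>) \<^bold>\<rightarrow> \<^bold>\<box> (\<phi> \<^bold>\<and> \<psi>))"
| "QBK_axiom (\<^bold>\<box> (\<phi> \<^bold>\<rightarrow> \<phi>))"
| "QBK_axiom (\<^bold>\<not> (\<^bold>\<box> \<phi>) \<^bold>\<leftrightarrow> \<^bold>\<diamond> (\<^bold>\<not> \<phi>))"
| "QBK_axiom (\<^bold>\<not> (\<^bold>\<diamond> \<phi>) \<^bold>\<leftrightarrow> \<^bold>\<box> (\<^bold>\<not> \<phi>))"
| "QBK_axiom (\<^bold>\<box> \<phi> \<^bold>\<Leftrightarrow> \<^bold>\<sim> (\<^bold>\<diamond> (\<^bold>\<sim> \<phi>)))"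
| "QBK_axiom (\<^bold>\<diamond> \<phi> \<^bold>\<Leftrightarrow> \<^bold>\<sim> (\<^bold>\<box> (\<^bold>\<sim> \<phi>)))"
| "free_for t x \<phi> \<Longrightarrow> QBK_axiom (All x \<phi> \<^bold>\<rightarrow> subst \<phi> x t)"
| "free_for t x \<phi> \<Longrightarrow> QBK_axiom (subst \<phi> x t \<^bold>\<rightarrow> Ex x \<phi>)"
| "QBK_axiom (\<^bold>\<sim> (All x \<phi>) \<^bold>\<leftrightarrow> Ex x (\<^bold>\<sim> \<phi>))"
| "QBK_axiom (\<^bold>\<sim> (Ex x \<phi>) \<^bold>\<leftrightarrow> All x (\<^bold>\<sim> \<phi>))"

inductive_set QBK :: "('p, 'c) signature \<Rightarrow> ('p, 'c) fm set" for \<sigma> where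
  Ax: "\<lbrakk>QBK_axiom \<phi>; \<phi> \<in> Form \<sigma>\<rbrakk> \<Longrightarrow> \<phi> \<in> QBK \<sigma>"
| MP: "\<lbrakk>\<phi> \<in> QBK \<sigma>; (\<phi> \<^bold>\<rightarrow> \<psi>) \<in> QBK \<sigma>\<rbrakk> \<Longrightarrow> \<psi> \<in> QBK \<sigma>"
| MB: "(\<phi> \<^bold>\<rightarrow> \<psi>) \<in> QBK \<sigma> \<Longrightarrow> (\<^bold>\<box> \<phi> \<^bold>\<rightarrow> \<^bold>\<box> \<psi>) \<in> QBK \<sigma>"
| MD: "(\<phi> \<^bold>\<rightarrow> \<psi>) \<in> QBK \<sigma> \<Longrightarrow> (\<^bold>\<diamond> \<phi> \<^bold>\<rightarrow> \<^bold>\<diamond> \<psi>) \<in> QBK \<sigma>"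
| BR1: "\<lbrakk>(\<phi> \<^bold>\<rightarrow> \<psi>) \<in> QBK \<sigma>; x \<notin> fv \<phi>\<rbrakk> \<Longrightarrow> (\<phi> \<^bold>\<rightarrow> All x \<psi>) \<in> QBK \<sigma>"
| BR2: "\<lbrakk>(\<phi> \<^bold>\<rightarrow> \<psi>) \<in> QBK \<sigma>; x \<notin> fv \<psi>\<rbrakk> \<Longrightarrow> (Ex x \<phi> \<^bold>\<rightarrow> \<psi>) \<in> QBK \<sigma>"

inductive_set consequences :: "('p, 'c) signature \<Rightarrow> ('p, 'c) fm set \<Rightarrow> ('p, 'c) fm set"
  for \<sigma> \<Gamma> where
  Hyp: "\<phi> \<in> \<Gamma> \<union> QBK \<sigma> \<Longrightarrow> \<phi> \<in> consequences \<sigma> \<Gamma>"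
| MP: "\<lbrakk>\<phi> \<in> consequences \<sigma> \<Gamma>; (\<phi> \<^bold>\<rightarrow> \<psi>) \<in> consequences \<sigma> \<Gamma>\<rbrakk> \<Longrightarrow> \<psi> \<in> consequences \<sigma> \<Gamma>"
| BR1: "\<lbrakk>(\<phi> \<^bold>\<rightarrow> \<psi>) \<in> consequences \<sigma> \<Gamma>; x \<notin> fv \<phi>\<rbrakk> \<Longrightarrow> (\<phi> \<^bold>\<rightarrow> All x \<psi>) \<in> consequences \<sigma> \<Gamma>"
| BR2: "\<lbrakk>(\<phi> \<^bold>\<rightarrow> \<psi>) \<in> consequences \<sigma> \<Gamma>; x \<notin> fv \<psi>\<rbrakk> \<Longrightarrow> (Ex x \<phi> \<^bold>\<rightarrow> \<psi>) \<in> consequences \<sigma> \<Gamma>"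

text \<open>Nonempty finite disjunctions, with arbitrary bracketing.\<close>

inductive_set Disj1 :: "('p, 'c) fm set \<Rightarrow> ('p, 'c) fm set" for \<Delta> where
  "\<phi> \<in> \<Delta> \<Longrightarrow> \<phi> \<in> Disj1 \<Delta>"
| "\<lbrakk>\<phi> \<in> Disj1 \<Delta>; \<psi> \<in> Disj1 \<Delta>\<rbrakk> \<Longrightarrow> (\<phi> \<^bold>\<or> \<psi>) \<in> Disj1 \<Delta>"

definition Disj :: "('p, 'c) fm set \<Rightarrow> ('p, 'c) fm set" where
  "Disj \<Delta> = insert \<^bold>\<bottom> (Disj1 \<Delta>)"

definition derives :: "('p, 'c) signature \<Rightarrow> ('p, 'c) fm set \<Rightarrow> ('p, 'c) fm set \<Rightarrow> bool" where
  "derives \<sigma> \<Gamma> \<Delta> \<longleftrightarrow> (\<exists>\<phi> \<in> Disj \<Delta>. \<phi> \<in> consequences \<sigma> \<Gamma>)"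

record ('p, 'c, 'a) struct =
  domain :: "'a set"
  const_int :: "'c \<Rightarrow> 'a"
  pred_int :: "'p \<Rightarrow> 'a list set"

definition is_struct :: "('p, 'c) signature \<Rightarrow> ('p, 'c, 'a) struct \<Rightarrow> bool" where
  "is_struct \<sigma> \<AA> \<longleftrightarrow>
     domain \<AA> \<noteq> {} \<and>
     (\<forall>c \<in> consts_of \<sigma>. const_int \<AA> c \<in> domain \<AA>) \<and>
     (\<forall>P \<in> preds \<sigma>. pred_int \<AA> P \<subseteq> {as. length as = arity \<sigma> P \<and> set as \<subseteq> domain \<AA>})"

record ('w, 'p, 'c, 'a) model =
  worlds :: "'w set"
  acc :: "('w \<times> 'w) set"
  pos :: "'w \<Rightarrow> ('p, 'c, 'a) struct"
  neg :: "'w \<Rightarrow> ('p, 'c, 'a) struct"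

definition is_QBK_model :: "('p, 'c) signature \<Rightarrow> ('w, 'p, 'c, 'a) model \<Rightarrow> bool" where
  "is_QBK_model \<sigma> M \<longleftrightarrow>
     worlds M \<noteq> {} \<and> acc M \<subseteq> worlds M \<times> worlds M \<and>
     (\<forall>w \<in> worlds M.
        is_struct \<sigma> (pos M w) \<and> is_struct \<sigma> (neg M w) \<and>
        domain (pos M w) = domain (neg M w) \<and>
        (\<forall>c \<in> consts_of \<sigma>. const_int (pos M w) c = const_int (neg M w) c)) \<and>
     (\<forall>(u, v) \<in> acc M.
        domain (pos M u) \<subseteq> domain (pos M v) \<and>
        (\<forall>c \<in> consts_of \<sigma>. const_int (pos M u) c = const_int (pos M v) c))"

text \<open>Formulas over the signature expanded by names of elements of type \<open>'a\<close> have constants of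
  type \<open>'c + 'a\<close>: \<open>Inl c\<close> is the original constant \<open>c\<close>, and \<open>Inr a\<close> is the name of \<open>a\<close>.
  The evaluation of open terms is irrelevant, since only sentences are evaluated.\<close>

primrec val :: "('p, 'c, 'a) struct \<Rightarrow> ('c + 'a) tm \<Rightarrow> 'a" where
  "val \<AA> (Const c) = (case c of Inl d \<Rightarrow> const_int \<AA> d | Inr a \<Rightarrow> a)"
| "val \<AA> (Var x) = undefined"

abbreviation name :: "'a \<Rightarrow> ('c + 'a) tm" where
  "name a \<equiv> Const (Inr a)"

abbreviation expand :: "('p, 'c) fm \<Rightarrow> ('p, 'c + 'a) fm" where
  "expand \<equiv> map_fm id Inl"

primrec height :: "('p, 'c) fm \<Rightarrow> nat" where
  "height (Atom P ts) = 0"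
| "height \<^bold>\<bottom> = 0"
| "height (\<phi> \<^bold>\<rightarrow> \<psi>) = Suc (max (height \<phi>) (height \<psi>))"
| "height (\<phi> \<^bold>\<and> \<psi>) = Suc (max (height \<phi>) (height \<psi>))"
| "height (\<phi> \<^bold>\<or> \<psi>) = Suc (max (height \<phi>) (height \<psi>))"
| "height (\<^bold>\<sim> \<phi>) = Suc (height \<phi>)"
| "height (\<^bold>\<box> \<phi>) = Suc (height \<phi>)"
| "height (\<^bold>\<diamond> \<phi>) = Suc (height \<phi>)"
| "height (All x \<phi>) = Suc (height \<phi>)"
| "height (Ex x \<phi>) = Suc (height \<phi>)"

lemma height_ssubst [simp]: "height (ssubst s \<phi>) = height \<phi>"
  by (induction \<phi> arbitrary: s) auto

lemma height_subst [simp]: "height (subst \<phi> x t) = height \<phi>"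
  by (simp add: subst_def)

function verifies :: "('w, 'p, 'c, 'a) model \<Rightarrow> 'w \<Rightarrow> ('p, 'c + 'a) fm \<Rightarrow> bool"
  and falsifies :: "('w, 'p, 'c, 'a) model \<Rightarrow> 'w \<Rightarrow> ('p, 'c + 'a) fm \<Rightarrow> bool" where
  "verifies M w (Atom P ts) \<longleftrightarrow> map (val (pos M w)) ts \<in> pred_int (pos M w) P"
| "verifies M w \<^bold>\<bottom> \<longleftrightarrow> False"
| "verifies M w (\<phi> \<^bold>\<rightarrow> \<psi>) \<longleftrightarrow> \<not> verifies M w \<phi> \<or> verifies M w \<psi>"
| "verifies M w (\<phi> \<^bold>\<and> \<psi>) \<longleftrightarrow> verifies M w \<phi> \<and> verifies M w \<psi>"
| "verifies M w (\<phi> \<^bold>\<or> \<psi>) \<longleftrightarrow> verifies M w \<phi> \<or> verifies M w \<psi>"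
| "verifies M w (\<^bold>\<sim> \<phi>) \<longleftrightarrow> falsifies M w \<phi>"
| "verifies M w (\<^bold>\<box> \<phi>) \<longleftrightarrow> (\<forall>v. (w, v) \<in> acc M \<longrightarrow> verifies M v \<phi>)"
| "verifies M w (\<^bold>\<diamond> \<phi>) \<longleftrightarrow> (\<exists>v. (w, v) \<in> acc M \<and> verifies M v \<phi>)"
| "verifies M w (All x \<phi>) \<longleftrightarrow> (\<forall>a \<in> domain (pos M w). verifies M w (subst \<phi> x (name a)))"
| "verifies M w (Ex x \<phi>) \<longleftrightarrow> (\<exists>a \<in> domain (pos M w). verifies M w (subst \<phi> x (name a)))"
| "falsifies M w (Atom P ts) \<longleftrightarrow> map (val (neg M w)) ts \<in> pred_int (neg M w) P"
| "falsifies M w \<^bold>\<bottom> \<longleftrightarrow> True"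
| "falsifies M w (\<phi> \<^bold>\<rightarrow> \<psi>) \<longleftrightarrow> verifies M w \<phi> \<and> falsifies M w \<psi>"
| "falsifies M w (\<phi> \<^bold>\<and> \<psi>) \<longleftrightarrow> falsifies M w \<phi> \<or> falsifies M w \<psi>"
| "falsifies M w (\<phi> \<^bold>\<or> \<psi>) \<longleftrightarrow> falsifies M w \<phi> \<and> falsifies M w \<psi>"
| "falsifies M w (\<^bold>\<sim> \<phi>) \<longleftrightarrow> verifies M w \<phi>"
| "falsifies M w (\<^bold>\<box> \<phi>) \<longleftrightarrow> (\<exists>v. (w, v) \<in> acc M \<and> falsifies M v \<phi>)"
| "falsifies M w (\<^bold>\<diamond> \<phi>) \<longleftrightarrow> (\<forall>v. (w, v) \<in> acc M \<longrightarrow> falsifies M v \<phi>)"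
| "falsifies M w (All x \<phi>) \<longleftrightarrow> (\<exists>a \<in> domain (pos M w). falsifies M w (subst \<phi> x (name a)))"
| "falsifies M w (Ex x \<phi>) \<longleftrightarrow> (\<forall>a \<in> domain (pos M w). falsifies M w (subst \<phi> x (name a)))"
  by pat_completeness auto
termination
  by (relation "measure (case_sum (\<lambda>(M, w, \<phi>). height \<phi>) (\<lambda>(M, w, \<phi>). height \<phi>))") auto

definition ground_subst :: "'a set \<Rightarrow> (var \<Rightarrow> ('c + 'a) tm) \<Rightarrow> bool" where
  "ground_subst A l \<longleftrightarrow> (\<forall>x. l x \<in> name ` A)"

text \<open>The type arguments fix the types of worlds and of individuals of the models; a statement with
  free type variables in these places covers models over all types.\<close>

definition entails ::
  "'w itself \<Rightarrow> 'a itself \<Rightarrow> ('p, 'c) signature \<Rightarrow> ('p, 'c) fm set \<Rightarrow> ('p, 'c) fm set \<Rightarrow> bool"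
where
  "entails _ _ \<sigma> \<Gamma> \<Delta> \<longleftrightarrow>
     (\<forall>(M :: ('w, 'p, 'c, 'a) model) w l.
        is_QBK_model \<sigma> M \<and> w \<in> worlds M \<and> ground_subst (domain (pos M w)) l \<and>
        (\<forall>\<phi> \<in> \<Gamma>. verifies M w (expand \<phi>)) \<longrightarrow>
        (\<exists>\<psi> \<in> \<Delta>. verifies M w (ssubst l (expand \<psi>))))"

end

theory Submission
  imports Defs
begin

text \<open>Replacing substitution of names by an assignment of individuals to variables turns the
  semantics into a compositional one. Soundness then is an induction on derivations, with the claim
  quantified over all assignments into the domain of the world considered: the Bernays rules need
  the free choice of the value of a variable, and the modal rules need that an assignment into the
  domain of a world is also one into the domain of each accessible world. The substitution lemma
  for terms \<open>t\<close> holds across modal operators because constants are rigid along accessibility.\<close>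

section \<open>Semantics by assignments\<close>

primrec tm_eval :: "('p, 'c, 'a) struct \<Rightarrow> (var \<Rightarrow> 'a) \<Rightarrow> 'c tm \<Rightarrow> 'a" where
  "tm_eval \<AA> e (Var x) = e x"
| "tm_eval \<AA> e (Const c) = const_int \<AA> c"

text \<open>The flag \<open>b\<close> selects verification (\<open>True\<close>) or falsification (\<open>False\<close>).\<close>

primrec sat :: "('w, 'p, 'c, 'a) model \<Rightarrow> ('p, 'c) fm \<Rightarrow> bool \<Rightarrow> 'w \<Rightarrow> (var \<Rightarrow> 'a) \<Rightarrow> bool" where
  "sat M (Atom P ts) b w e \<longleftrightarrow>
     (let \<AA> = if b then pos M w else neg M w in map (tm_eval \<AA> e) ts \<in> pred_int \<AA> P)"
| "sat M \<^bold>\<bottom> b w e \<longleftrightarrow> \<not> b"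
| "sat M (\<phi> \<^bold>\<rightarrow> \<psi>) b w e \<longleftrightarrow>
     (if b then sat M \<phi> True w e \<longrightarrow> sat M \<psi> True w e else sat M \<phi> True w e \<and> sat M \<psi> False w e)"
| "sat M (\<phi> \<^bold>\<and> \<psi>) b w e \<longleftrightarrow>
     (if b then sat M \<phi> b w e \<and> sat M \<psi> b w e else sat M \<phi> b w e \<or> sat M \<psi> b w e)"
| "sat M (\<phi> \<^bold>\<or> \<psi>) b w e \<longleftrightarrow>
     (if b then sat M \<phi> b w e \<or> sat M \<psi> b w e else sat M \<phi> b w e \<and> sat M \<psi> b w e)"
| "sat M (\<^bold>\<sim> \<phi>) b w e \<longleftrightarrow> sat M \<phi> (\<not> b) w e"
| "sat M (\<^bold>\<box> \<phi>) b w e \<longleftrightarrow>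
     (if b then \<forall>v. (w, v) \<in> acc M \<longrightarrow> sat M \<phi> b v e else \<exists>v. (w, v) \<in> acc M \<and> sat M \<phi> b v e)"
| "sat M (\<^bold>\<diamond> \<phi>) b w e \<longleftrightarrow>
     (if b then \<exists>v. (w, v) \<in> acc M \<and> sat M \<phi> b v e else \<forall>v. (w, v) \<in> acc M \<longrightarrow> sat M \<phi> b v e)"
| "sat M (All x \<phi>) b w e \<longleftrightarrow>
     (if b then \<forall>a \<in> domain (pos M w). sat M \<phi> b w (e(x := a))
      else \<exists>a \<in> domain (pos M w). sat M \<phi> b w (e(x := a)))"
| "sat M (Ex x \<phi>) b w e \<longleftrightarrow>
     (if b then \<exists>a \<in> domain (pos M w). sat M \<phi> b w (e(x := a))
      else \<forall>a \<in> domain (pos M w). sat M \<phi> b w (e(x := a)))"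

section \<open>Syntactic facts on substitution\<close>

lemma ssubst_tm_idle: "(\<And>x. x \<in> fv_tm t \<Longrightarrow> s x = Var x) \<Longrightarrow> ssubst_tm s t = t"
  by (cases t) auto

lemma ssubst_idle: "(\<And>x. x \<in> fv \<phi> \<Longrightarrow> s x = Var x) \<Longrightarrow> ssubst s \<phi> = \<phi>"
proof (induction \<phi> arbitrary: s)
  case (Atom P ts)
  then show ?case by (auto intro!: map_idI ssubst_tm_idle)
qed auto

lemma fv_tm_map_tm [simp]: "fv_tm (map_tm f t) = fv_tm t"
  by (cases t) auto

lemma fv_map_fm [simp]: "fv (map_fm f g \<phi>) = fv \<phi>"
  by (induction \<phi>) auto

text \<open>An instance of a quantifier axiom is only required to be a formula over
  \<open>\<sigma>\<close> as a whole. A free occurrence of \<open>x\<close> puts \<open>s x\<close>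
  into the result, so well-formedness of the substituted term can be read off from it.\<close>

lemma wf_tm_of_wf_ssubst:
  "wf_fm \<sigma> (ssubst s \<phi>) \<Longrightarrow> x \<in> fv \<phi> \<Longrightarrow> wf_tm \<sigma> (s x)"
proof (induction \<phi> arbitrary: s)
  case (Atom P ts)
  then obtain t where "t \<in> set ts" "x \<in> fv_tm t" by auto
  with Atom show ?case by (cases t) auto
next
  case (All y \<phi>)
  then have "wf_tm \<sigma> ((s(y := Var y)) x)" by (intro All.IH) (simp_all del: fun_upd_apply)
  with All.prems show ?case by simp
next
  case (Ex y \<phi>)
  then have "wf_tm \<sigma> ((s(y := Var y)) x)" by (intro Ex.IH) (simp_all del: fun_upd_apply)
  with Ex.prems show ?case by simp
qed auto

lemma ssubst_tm_ssubst_tm: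
  "(\<And>y. ssubst_tm s' (s y) = s'' y) \<Longrightarrow> ssubst_tm s' (ssubst_tm s t) = ssubst_tm s'' t"
  by (cases t) auto

text \<open>The left side is what the quantifier clauses of \<open>verifies\<close> and
  \<open>falsifies\<close> produce: \<open>x\<close> is held back under its binder and receives its
  name afterwards. Names contain no variables, so neither capture nor further replacement can
  occur.\<close>

lemma subst_name_ssubst:
  "subst (ssubst ((\<lambda>y. name (e y))(x := Var x)) \<phi>) x (name a) = ssubst (\<lambda>y. name ((e(x := a)) y)) \<phi>"
proof -
  \<comment> \<open>The condition on the three maps is chosen to survive a binder, which adds
    \<open>y := Var y\<close> to each of them: a variable is either left alone by \<open>s\<close>
    and then treated by \<open>s'\<close>, or becomes a constant, which \<open>s'\<close> cannot
    change.\<close>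
  have "ssubst s' (ssubst s \<phi>) = ssubst s'' \<phi>"
    if "\<And>y. s y = Var y \<and> s'' y = s' y \<or> (\<exists>c. s y = Const c \<and> s'' y = Const c)" for s s' s''
    using that
  proof (induction \<phi> arbitrary: s s' s'')
    case (Atom P ts)
    have "ssubst_tm s' (s y) = s'' y" for y using Atom[of y] by auto
    then show ?case by (simp add: ssubst_tm_ssubst_tm)
  next
    case (All y \<phi>)
    have "ssubst (s'(y := Var y)) (ssubst (s(y := Var y)) \<phi>) = ssubst (s''(y := Var y)) \<phi>"
    proof (rule All.IH)
      show "(s(y := Var y)) z = Var z \<and> (s''(y := Var y)) z = (s'(y := Var y)) z \<or>
        (\<exists>c. (s(y := Var y)) z = Const c \<and> (s''(y := Var y)) z = Const c)" for z
        using All.prems[of z] by auto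
    qed
    then show ?case by (simp del: fun_upd_apply)
  next
    case (Ex y \<phi>)
    have "ssubst (s'(y := Var y)) (ssubst (s(y := Var y)) \<phi>) = ssubst (s''(y := Var y)) \<phi>"
    proof (rule Ex.IH)
      show "(s(y := Var y)) z = Var z \<and> (s''(y := Var y)) z = (s'(y := Var y)) z \<or>
        (\<exists>c. (s(y := Var y)) z = Const c \<and> (s''(y := Var y)) z = Const c)" for z
        using Ex.prems[of z] by auto
    qed
    then show ?case by (simp del: fun_upd_apply)
  qed auto
  then show ?thesis by (simp add: subst_def)
qed

section \<open>Agreement of the two semantics\<close>

lemma val_ssubst_tm_expand:
  "val \<AA> (ssubst_tm (\<lambda>y. name (e y)) (map_tm Inl t)) = tm_eval \<AA> e t"
  by (cases t) auto

text \<open>Both equivalences are proved in one induction, because strong negation swaps them and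
  falsifying an implication involves verifying its antecedent. The quantifier cases pass to
  \<open>e(x := a)\<close> by \<open>subst_name_ssubst\<close>.\<close>

lemma verifies_falsifies_iff_sat:
  "verifies M w (ssubst (\<lambda>y. name (e y)) (expand \<phi>)) \<longleftrightarrow> sat M \<phi> True w e"
  "falsifies M w (ssubst (\<lambda>y. name (e y)) (expand \<phi>)) \<longleftrightarrow> sat M \<phi> False w e"
  by (induction \<phi> arbitrary: w e)
    (simp_all add: Let_def val_ssubst_tm_expand comp_def subst_name_ssubst del: fun_upd_apply)

section \<open>Coincidence and the substitution lemma\<close>

lemma tm_eval_cong: "(\<And>x. x \<in> fv_tm t \<Longrightarrow> e x = e' x) \<Longrightarrow> tm_eval \<AA> e t = tm_eval \<AA> e' t"
  by (cases t) auto

lemma sat_cong: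
  fixes M :: "('w, 'p, 'c, 'a) model"
  shows "(\<And>x. x \<in> fv \<phi> \<Longrightarrow> e x = e' x) \<Longrightarrow> sat M \<phi> b w e = sat M \<phi> b w e'"
proof (induction \<phi> arbitrary: b w e e')
  case (Atom P ts)
  \<comment> \<open>Left open in the structure, since the flag decides between
    \<open>pos M w\<close> and \<open>neg M w\<close>.\<close>
  then have "map (tm_eval \<AA> e) ts = map (tm_eval \<AA> e') ts" for \<AA> :: "('p, 'c, 'a) struct"
    by (auto intro: tm_eval_cong)
  then show ?case by (simp add: Let_def del: map_eq_conv)
next
  case (Imp \<phi> \<psi>)
  show ?case using Imp.IH[of e e'] Imp.prems by simp
next
  case (And \<phi> \<psi>)
  show ?case using And.IH[of e e'] And.prems by simp
next
  case (Or \<phi> \<psi>)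
  show ?case using Or.IH[of e e'] Or.prems by simp
next
  case (SNeg \<phi>)
  show ?case using SNeg.IH[of e e'] SNeg.prems by simp
next
  case (Box \<phi>)
  show ?case using Box.IH[of e e'] Box.prems by simp
next
  case (Dia \<phi>)
  show ?case using Dia.IH[of e e'] Dia.prems by simp
next
  case (All x \<phi>)
  have "sat M \<phi> b w (e(x := a)) = sat M \<phi> b w (e'(x := a))" for a
    using All.prems by (intro All.IH) auto
  then show ?case by (cases b) simp_all
next
  case (Ex x \<phi>)
  have "sat M \<phi> b w (e(x := a)) = sat M \<phi> b w (e'(x := a))" for a
    using Ex.prems by (intro Ex.IH) auto
  then show ?case by (cases b) simp_all
qed simp

lemma tm_eval_fun_upd_idle: "y \<notin> fv_tm t \<Longrightarrow> tm_eval \<AA> (e(y := a)) t = tm_eval \<AA> e t"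
  by (rule tm_eval_cong) auto

lemma tm_eval_rigid:
  assumes "is_QBK_model \<sigma> M" "wf_tm \<sigma> t" "(w, v) \<in> acc M"
  shows "tm_eval (pos M v) e t = tm_eval (pos M w) e t"
  using assms by (cases t) (fastforce simp: is_QBK_model_def)+

text \<open>Lets the substitution lemma use the value of \<open>t\<close> in \<open>pos M w\<close>
  for both flags, although atoms are falsified through \<open>neg M w\<close>.\<close>

lemma tm_eval_neg:
  assumes "is_QBK_model \<sigma> M" "wf_tm \<sigma> t" "w \<in> worlds M"
  shows "tm_eval (neg M w) e t = tm_eval (pos M w) e t"
  using assms by (cases t) (auto simp: is_QBK_model_def)

lemma tm_eval_in_domain:
  assumes "is_QBK_model \<sigma> M" "wf_tm \<sigma> t" "w \<in> worlds M" "range e \<subseteq> domain (pos M w)"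
  shows "tm_eval (pos M w) e t \<in> domain (pos M w)"
  using assms by (cases t) (auto simp: is_QBK_model_def is_struct_def)

lemma tm_eval_ssubst_tm:
  "tm_eval \<AA> e (ssubst_tm (Var(x := t)) u) = tm_eval \<AA> (e(x := tm_eval \<AA> e t)) u"
  by (cases u) auto

lemma acc_worlds: "is_QBK_model \<sigma> M \<Longrightarrow> (w, v) \<in> acc M \<Longrightarrow> v \<in> worlds M"
  by (auto simp: is_QBK_model_def)

text \<open>Covers the case in which \<open>free_for\<close> puts no constraint on \<open>t\<close>.
  Neither side depends on \<open>x\<close>, so \<open>a\<close> is arbitrary.\<close>

lemma sat_subst_idle:
  assumes "x \<notin> fv \<phi>"
  shows "sat M (subst \<phi> x t) b w e = sat M \<phi> b w (e(x := a))"
proof -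
  have "subst \<phi> x t = \<phi>"
    unfolding subst_def using assms by (intro ssubst_idle) auto
  moreover have "sat M \<phi> b w e = sat M \<phi> b w (e(x := a))"
    using assms by (intro sat_cong) auto
  ultimately show ?thesis by simp
qed

lemma sat_subst:
  assumes M: "is_QBK_model \<sigma> M" and t: "wf_tm \<sigma> t"
  shows "w \<in> worlds M \<Longrightarrow> free_for t x \<phi> \<Longrightarrow>
    sat M (subst \<phi> x t) b w e = sat M \<phi> b w (e(x := tm_eval (pos M w) e t))"
proof (induction \<phi> arbitrary: b w e)
  case (Atom P ts)
  then show ?case
    by (simp add: subst_def Let_def comp_def tm_eval_ssubst_tm tm_eval_neg[OF M t]
        del: fun_upd_apply)
next
  case (Box \<phi>)
  \<comment> \<open>The induction hypothesis at \<open>v\<close> speaks of the value of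
    \<open>t\<close> at \<open>v\<close>; rigidity replaces it by the value at \<open>w\<close>, the
    same for all successors.\<close>
  have "sat M (subst \<phi> x t) b v e = sat M \<phi> b v (e(x := tm_eval (pos M w) e t))"
    if "(w, v) \<in> acc M" for v
    using Box.IH[of v b e] Box.prems acc_worlds[OF M that] tm_eval_rigid[OF M t that]
    by (simp del: fun_upd_apply)
  then show ?case by (auto simp: subst_def simp del: fun_upd_apply)
next
  case (Dia \<phi>)
  have "sat M (subst \<phi> x t) b v e = sat M \<phi> b v (e(x := tm_eval (pos M w) e t))"
    if "(w, v) \<in> acc M" for v
    using Dia.IH[of v b e] Dia.prems acc_worlds[OF M that] tm_eval_rigid[OF M t that]
    by (simp del: fun_upd_apply)
  then show ?case by (auto simp: subst_def simp del: fun_upd_apply)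
next
  case (All y \<phi>)
  show ?case
  \<comment> \<open>The split mirrors \<open>free_for\<close>. If \<open>x\<close> is free, then
    \<open>y\<close> does not occur in \<open>t\<close>, so updating \<open>y\<close> keeps the
    value of \<open>t\<close>, and the two updates commute. Otherwise the substitution changes
    nothing.\<close>
  proof (cases "x \<in> fv (All y \<phi>)")
    case True
    with All.prems have y: "x \<noteq> y" "y \<notin> fv_tm t" "free_for t x \<phi>" by auto
    have "subst (All y \<phi>) x t = All y (subst \<phi> x t)"
      using y by (simp add: subst_def fun_upd_twist[of x y] fun_upd_idem)
    moreover have "sat M (subst \<phi> x t) b w (e(y := a)) =
        sat M \<phi> b w (e(x := tm_eval (pos M w) e t, y := a))" for a
      using All.IH[of w b "e(y := a)"] All.prems y
      by (simp add: tm_eval_fun_upd_idle fun_upd_twist[of x y] del: fun_upd_apply)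
    ultimately show ?thesis by (cases b) (simp_all del: fun_upd_apply)
  qed (rule sat_subst_idle)
next
  case (Ex y \<phi>)
  show ?case
  proof (cases "x \<in> fv (Ex y \<phi>)")
    case True
    with Ex.prems have y: "x \<noteq> y" "y \<notin> fv_tm t" "free_for t x \<phi>" by auto
    have "subst (Ex y \<phi>) x t = Ex y (subst \<phi> x t)"
      using y by (simp add: subst_def fun_upd_twist[of x y] fun_upd_idem)
    moreover have "sat M (subst \<phi> x t) b w (e(y := a)) =
        sat M \<phi> b w (e(x := tm_eval (pos M w) e t, y := a))" for a
      using Ex.IH[of w b "e(y := a)"] Ex.prems y
      by (simp add: tm_eval_fun_upd_idle fun_upd_twist[of x y] del: fun_upd_apply)
    ultimately show ?thesis by (cases b) (simp_all del: fun_upd_apply)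
  qed (rule sat_subst_idle)
qed (simp_all add: subst_def del: fun_upd_apply)

text \<open>If \<open>x\<close> does not occur free in \<open>\<phi>\<close>, then \<open>t\<close> may contain constants outside the signature,
  and any element of the nonempty domain serves as a witness.\<close>

lemma sat_subst_witness:
  assumes M: "is_QBK_model \<sigma> M" and w: "w \<in> worlds M" and e: "range e \<subseteq> domain (pos M w)"
    and "free_for t x \<phi>" and wf: "wf_fm \<sigma> (subst \<phi> x t)"
  shows "\<exists>a \<in> domain (pos M w). sat M (subst \<phi> x t) True w e = sat M \<phi> True w (e(x := a))"
proof (cases "x \<in> fv \<phi>")
  case True
  have t: "wf_tm \<sigma> t"
    using wf_tm_of_wf_ssubst[OF wf[unfolded subst_def] True] by simp
  show ?thesis
    using sat_subst[OF M t w \<open>free_for t x \<phi>\<close>] tm_eval_in_domain[OF M t w e] by blast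
next
  case False
  then have "sat M (subst \<phi> x t) True w e = sat M \<phi> True w (e(x := e x))"
    by (rule sat_subst_idle)
  moreover have "e x \<in> domain (pos M w)" using e by blast
  ultimately show ?thesis by (rule bexI)
qed

section \<open>Soundness of axioms and rules\<close>

lemma QBK_axiom_sound:
  assumes "QBK_axiom \<phi>" "wf_fm \<sigma> \<phi>" "is_QBK_model \<sigma> M" "w \<in> worlds M"
    "range e \<subseteq> domain (pos M w)"
  shows "sat M \<phi> True w e"
  using assms
proof (induction rule: QBK_axiom.induct)
  \<comment> \<open>Cases 22 and 23 are the instantiation axioms: the element given by
    \<open>sat_subst_witness\<close> is an instance for \<open>All\<close> and a witness for
    \<open>Ex\<close>. The other axioms follow by unfolding \<open>sat\<close>.\<close>
  case (22 t x \<phi>)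
  then show ?case using sat_subst_witness[of \<sigma> M w e t x \<phi>] by auto
next
  case (23 t x \<phi>)
  then show ?case using sat_subst_witness[of \<sigma> M w e t x \<phi>] by auto
qed auto

lemma range_subset_acc:
  "is_QBK_model \<sigma> M \<Longrightarrow> (w, v) \<in> acc M \<Longrightarrow> range e \<subseteq> domain (pos M w) \<Longrightarrow>
    range e \<subseteq> domain (pos M v)"
  by (fastforce simp: is_QBK_model_def)

text \<open>Apply the premise at \<open>e(x := a)\<close>: the antecedent does not notice the change
  at \<open>x\<close>. The world is fixed, so that the lemma serves both \<open>QBK\<close> and
  \<open>consequences\<close>.\<close>

lemma sat_Imp_All:
  assumes "\<And>e. range e \<subseteq> domain (pos M w) \<Longrightarrow> sat M (\<phi> \<^bold>\<rightarrow> \<psi>) True w e"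
    and "x \<notin> fv \<phi>" and e: "range e \<subseteq> domain (pos M w)"
  shows "sat M (\<phi> \<^bold>\<rightarrow> All x \<psi>) True w e"
proof -
  have "sat M \<psi> True w (e(x := a))" if "a \<in> domain (pos M w)" "sat M \<phi> True w e" for a
  proof -
    have "range (e(x := a)) \<subseteq> domain (pos M w)" using e that by auto
    moreover have "sat M \<phi> True w (e(x := a)) = sat M \<phi> True w e"
      using assms(2) by (intro sat_cong) auto
    ultimately show ?thesis using assms(1)[of "e(x := a)"] that by simp
  qed
  then show ?thesis by simp
qed

lemma sat_Ex_Imp:
  assumes "\<And>e. range e \<subseteq> domain (pos M w) \<Longrightarrow> sat M (\<phi> \<^bold>\<rightarrow> \<psi>) True w e"
    and "x \<notin> fv \<psi>" and e: "range e \<subseteq> domain (pos M w)"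
  shows "sat M (Ex x \<phi> \<^bold>\<rightarrow> \<psi>) True w e"
proof -
  have "sat M \<psi> True w e" if "a \<in> domain (pos M w)" "sat M \<phi> True w (e(x := a))" for a
  proof -
    have "range (e(x := a)) \<subseteq> domain (pos M w)" using e that by auto
    moreover have "sat M \<psi> True w (e(x := a)) = sat M \<psi> True w e"
      using assms(2) by (intro sat_cong) auto
    ultimately show ?thesis using assms(1)[of "e(x := a)"] that by simp
  qed
  then show ?thesis by auto
qed

text \<open>The world is generalized along with the assignment, since \<open>MB\<close> and
  \<open>MD\<close> use the induction hypothesis at the successors of \<open>w\<close>.\<close>

lemma QBK_sound:
  assumes "\<phi> \<in> QBK \<sigma>" and M: "is_QBK_model \<sigma> M"
    and "w \<in> worlds M" "range e \<subseteq> domain (pos M w)"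
  shows "sat M \<phi> True w e"
  using assms(1,3,4)
proof (induction arbitrary: w e rule: QBK.induct)
  case (Ax \<phi>)
  then show ?case using QBK_axiom_sound[OF _ _ M] by (simp add: Form_def)
next
  case (MP \<phi> \<psi>)
  show ?case using MP.IH[OF MP.prems] by simp
next
  case (MB \<phi> \<psi>)
  have "sat M (\<phi> \<^bold>\<rightarrow> \<psi>) True v e" if "(w, v) \<in> acc M" for v
    using MB.IH acc_worlds[OF M that] range_subset_acc[OF M that] MB.prems by blast
  then show ?case by auto
next
  case (MD \<phi> \<psi>)
  have "sat M (\<phi> \<^bold>\<rightarrow> \<psi>) True v e" if "(w, v) \<in> acc M" for v
    using MD.IH acc_worlds[OF M that] range_subset_acc[OF M that] MD.prems by blast
  then show ?case by auto
next
  case (BR1 \<phi> \<psi> x)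
  show ?case by (rule sat_Imp_All) (use BR1 in blast)+
next
  case (BR2 \<phi> \<psi> x)
  show ?case by (rule sat_Ex_Imp) (use BR2 in blast)+
qed

text \<open>Here the world stays fixed: \<open>\<Gamma>\<close> is assumed true only at
  \<open>w\<close>, and the modal rules are confined to \<open>QBK\<close>. Truth of
  \<open>\<Gamma>\<close> under all assignments lets the Bernays rules vary the value of
  \<open>x\<close> in derivations from hypotheses.\<close>

lemma consequences_sound:
  assumes "\<phi> \<in> consequences \<sigma> \<Gamma>" and M: "is_QBK_model \<sigma> M" and w: "w \<in> worlds M"
    and \<Gamma>: "\<And>\<phi> e. \<phi> \<in> \<Gamma> \<Longrightarrow> sat M \<phi> True w e"
    and "range e \<subseteq> domain (pos M w)"
  shows "sat M \<phi> True w e"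
  using assms(1,5)
proof (induction arbitrary: e rule: consequences.induct)
  case (Hyp \<phi>)
  then show ?case using \<Gamma> QBK_sound[OF _ M w] by blast
next
  case (MP \<phi> \<psi>)
  show ?case using MP.IH[OF MP.prems] by simp
next
  case (BR1 \<phi> \<psi> x)
  show ?case by (rule sat_Imp_All) (use BR1 in blast)+
next
  case (BR2 \<phi> \<psi> x)
  show ?case by (rule sat_Ex_Imp) (use BR2 in blast)+
qed

lemma sat_Disj1: "\<phi> \<in> Disj1 \<Delta> \<Longrightarrow> sat M \<phi> True w e \<Longrightarrow> \<exists>\<psi> \<in> \<Delta>. sat M \<psi> True w e"
  by (induction rule: Disj1.induct) auto

section \<open>From ground substitutions to assignments and back\<close>

theorem theorem11:
  fixes \<sigma> :: "('p, 'c) signature" and \<Gamma> \<Delta> :: "('p, 'c) fm set"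
  assumes "\<Gamma> \<subseteq> Sent \<sigma>" and "\<Delta> \<subseteq> Form \<sigma>"
    and "derives \<sigma> \<Gamma> \<Delta>"
  shows "entails TYPE('w) TYPE('a) \<sigma> \<Gamma> \<Delta>"
  unfolding entails_def
proof (intro allI impI, elim conjE)
  fix M :: "('w, 'p, 'c, 'a) model" and w and l :: "var \<Rightarrow> ('c + 'a) tm"
  assume M: "is_QBK_model \<sigma> M" and w: "w \<in> worlds M"
    and l: "ground_subst (domain (pos M w)) l" and \<Gamma>: "\<forall>\<phi> \<in> \<Gamma>. verifies M w (expand \<phi>)"
  from l have "\<forall>x. \<exists>a. l x = name a \<and> a \<in> domain (pos M w)"
    by (auto simp: ground_subst_def)
  then obtain e where e: "\<And>x. l x = name (e x)" "\<And>x. e x \<in> domain (pos M w)"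
    by metis
  then have l_eq: "l = (\<lambda>x. name (e x))" and ran: "range e \<subseteq> domain (pos M w)"
    by auto
  \<comment> \<open>Members of \<open>\<Gamma>\<close> are sentences, so substituting names changes
    nothing and their truth at \<open>w\<close> holds under every assignment.\<close>
  have sat_\<Gamma>: "sat M \<phi> True w e'" if "\<phi> \<in> \<Gamma>" for \<phi> e'
  proof -
    have "fv \<phi> = {}" using that assms(1) by (auto simp: Sent_def)
    then have "ssubst (\<lambda>x. name (e' x)) (expand \<phi>) = expand \<phi>"
      by (intro ssubst_idle) simp
    then show ?thesis using \<Gamma> that verifies_falsifies_iff_sat(1)[of M w e' \<phi>] by simp
  qed
  from assms(3) obtain \<phi> where \<phi>: "\<phi> \<in> Disj \<Delta>" "\<phi> \<in> consequences \<sigma> \<Gamma>"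
    by (auto simp: derives_def)
  have "sat M \<phi> True w e"
    by (rule consequences_sound[OF \<phi>(2) M w sat_\<Gamma> ran])
  \<comment> \<open>The empty disjunction is excluded because \<open>sat\<close> never verifies it;
    any other member of \<open>Disj \<Delta>\<close> has a true disjunct.\<close>
  with \<phi>(1) have "\<exists>\<psi> \<in> \<Delta>. sat M \<psi> True w e"
    using sat_Disj1 by (auto simp: Disj_def)
  then show "\<exists>\<psi> \<in> \<Delta>. verifies M w (ssubst l (expand \<psi>))"
    by (simp add: l_eq verifies_falsifies_iff_sat(1))
qed

end
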